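(* (1) Let $R$ be a finite commutative local ring with unity whose maximal ideal $M$ is principal. Then the zero-divisor graph $\Gamma(R)$ is a threshold graph. (2) For every finite threshold graph $G$ there is a finite commutative local ring $R$ with unity whose maximal ideal is principal such that $G$ is isomorphic to an induced subgraph of $\Gamma(R)$.
   Context: Graphs are finite simple undirected graphs. A local ring is a ring with a unique maximal ideal. For a finite commutative ring $R$ with unity, the zero-divisor graph $\Gamma(R)$ has as vertices the non-zero elements $a\in R$ for which there exists $b\neq 0$ in $R$ with $ab=0$; two distinct vertices $a,b$ are adjacent if and only if $ab=0$. A graph $G$ is a threshold graph if there exist $t\in\mathbb{R}$ and a weight $w(v)\in\mathbb{R}$ for each vertex $v$ such that, for distinct vertices $u,v$, $uv$ is an edge of $G$ if and only if $w(u)+w(v)>t$. *)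

theory Defs
  imports
    "HOL-Algebra.Ideal"
    "Graph_Theory.Pair_Digraph"
    "Graph_Theory.Digraph_Isomorphism"
begin

text \<open>
  A finite simple undirected graph is a \<^locale>\<open>pair_graph\<close>: a finite vertex set together with a
  symmetric, loop-free set of ordered pairs; the undirected edge \<open>uv\<close> is represented by the two
  pairs \<open>(u, v)\<close> and \<open>(v, u)\<close>.
\<close>

locale threshold_graph = pair_graph G for G :: "'v pair_pre_digraph" +
  assumes threshold:
    "\<exists>(t::real) (w :: 'v \<Rightarrow> real). \<forall>u\<in>pverts G. \<forall>v\<in>pverts G.
       u \<noteq> v \<longrightarrow> ((u, v) \<in> parcs G \<longleftrightarrow> w u + w v > t)"

text \<open>The zero ring is not local, since a maximal ideal is by definition a proper ideal.\<close>

locale local_cring = cring R for R (structure) +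
  assumes unique_maximalideal: "\<exists>!M. maximalideal M R"

definition zero_divisor_verts :: "('r, 'm) ring_scheme \<Rightarrow> 'r set" where
  "zero_divisor_verts R =
     {a \<in> carrier R. a \<noteq> \<zero>\<^bsub>R\<^esub> \<and> (\<exists>b\<in>carrier R. b \<noteq> \<zero>\<^bsub>R\<^esub> \<and> a \<otimes>\<^bsub>R\<^esub> b = \<zero>\<^bsub>R\<^esub>)}"

definition zero_divisor_graph :: "('r, 'm) ring_scheme \<Rightarrow> 'r pair_pre_digraph" where
  "zero_divisor_graph R =
     \<lparr> pverts = zero_divisor_verts R,
       parcs = {(a, b). a \<in> zero_divisor_verts R \<and> b \<in> zero_divisor_verts R \<and>
                        a \<noteq> b \<and> a \<otimes>\<^bsub>R\<^esub> b = \<zero>\<^bsub>R\<^esub>} \<rparr>"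

end

theory Submission
  imports Defs "HOL-Number_Theory.Residues"
begin

text \<open>
  In a finite local ring with maximal ideal \<open>(p)\<close>, the generator \<open>p\<close> is nilpotent and every non-zero
  element is a unit times a power of \<open>p\<close>. If \<open>n\<close> is the nilpotency index of \<open>p\<close>, a product of two
  non-zero elements vanishes iff their exponents sum to at least \<open>n\<close>, so the exponents are threshold
  weights. Conversely, a threshold graph has integral weights, and after a shift these are realised
  as valuations in \<open>\<int>/p\<^sup>N\<close> for a prime \<open>p\<close> exceeding the number of vertices.
\<close>

section \<open>Finite local rings with principal maximal ideal\<close>

text \<open>In a finite ring there are only finitely many proper ideals, so one that is largest by
  inclusion above \<open>I\<close> exists.\<close>

lemma (in ring) finite_ideal_subset_maximalideal:
  assumes fin: "finite (carrier R)" and I: "ideal I R" "I \<noteq> carrier R"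
  obtains M where "maximalideal M R" "I \<subseteq> M"
proof -
  define S where "S = {J. ideal J R \<and> J \<noteq> carrier R}"
  have "S \<subseteq> Pow (carrier R)"
    unfolding S_def by (auto dest: ideal.Icarr)
  then have "finite S"
    using fin by (meson finite_Pow_iff finite_subset)
  moreover have "I \<in> S"
    using I by (simp add: S_def)
  ultimately obtain M where M: "M \<in> S" "I \<subseteq> M" "\<forall>J\<in>S. M \<subseteq> J \<longrightarrow> M = J"
    by (meson finite_has_maximal2)
  have "maximalideal M R"
    using M unfolding S_def by (intro maximalidealI) auto
  with M(2) that show thesis by blast
qed

text \<open>A non-unit generates a proper ideal, which lies in some maximal ideal; by uniqueness
  that ideal is \<open>M\<close>.\<close>

lemma (in local_cring) not_in_maximalideal_Units:
  assumes fin: "finite (carrier R)" and M: "maximalideal M R"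
    and x: "x \<in> carrier R" "x \<notin> M"
  shows "x \<in> Units R"
proof (rule ccontr)
  assume non_unit: "x \<notin> Units R"
  have "\<one> \<notin> PIdl x"
    using x non_unit unfolding cgenideal_def Units_def by (force simp: m_comm)
  then have "PIdl x \<noteq> carrier R" by auto
  then obtain N where N: "maximalideal N R" "PIdl x \<subseteq> N"
    using finite_ideal_subset_maximalideal[OF fin cgenideal_ideal[OF x(1)]] by blast
  have "N = M" using N M unique_maximalideal by auto
  with N(2) cgenideal_self[OF x(1)] x(2) show False by auto
qed

text \<open>A proper ideal contains no unit, so the non-units, once they form an ideal, are the
  largest proper ideal. This is the criterion by which the residue rings below are shown to be
  local.\<close>

lemma (in cring) local_cring_if_ideal_nonunits:
  assumes "ideal (carrier R - Units R) R"
  shows "local_cring R" "maximalideal (carrier R - Units R) R"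
proof -
  let ?N = "carrier R - Units R"
  have sub: "J \<subseteq> ?N" if J: "ideal J R" "J \<noteq> carrier R" for J
  proof
    fix x assume x: "x \<in> J"
    have "x \<notin> Units R"
    proof
      assume u: "x \<in> Units R"
      then have "inv x \<otimes> x \<in> J"
        using x J(1) by (intro ideal.I_l_closed) auto
      then show False
        using u J ideal.one_imp_carrier by fastforce
    qed
    with x J(1) show "x \<in> ?N" by (auto dest: ideal.Icarr)
  qed
  show max: "maximalideal ?N R"
    using assms sub by (intro maximalidealI) auto
  have "M = ?N" if "maximalideal M R" for M
  proof -
    interpret M: maximalideal M R by (fact that)
    have "M \<subseteq> ?N" using sub M.is_ideal M.I_notcarr by auto
    then show ?thesis
      using M.I_maximal[OF assms] maximalideal.I_notcarr[OF max] by auto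
  qed
  with max show "local_cring R"
    by unfold_locales auto
qed

text \<open>By finiteness two powers of \<open>p\<close> coincide, say p^a = p^(a+d) with d > 0, so
  p^a (1 - p^d) = 0. Since p^d lies in \<open>M\<close>, the factor 1 - p^d is a unit and
  cancels.\<close>

lemma (in local_cring) maximalideal_member_nilpotent:
  assumes fin: "finite (carrier R)" and M: "maximalideal M R"
    and p: "p \<in> M"
  obtains n :: nat where "p [^] n = \<zero>"
proof -
  interpret M: maximalideal M R by (fact M)
  have pc: "p \<in> carrier R" using p by (rule M.Icarr)
  have "finite (range (\<lambda>n::nat. p [^] n))"
    by (rule finite_subset[OF _ fin]) (use pc in auto)
  then have "\<not> inj (\<lambda>n::nat. p [^] n)"
    using finite_imageD infinite_UNIV_nat by blast
  then obtain a b :: nat where "a < b" "p [^] a = p [^] b"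
    unfolding inj_def by (metis linorder_neqE_nat)
  then obtain d where d: "d > 0" "p [^] a = p [^] (a + d)"
    by (metis less_imp_add_positive)
  have dM: "p [^] d \<in> M" using p pc d(1) by (cases d) (auto simp: M.I_l_closed)
  have dc: "p [^] d \<in> carrier R" using pc by blast
  have "\<one> \<ominus> p [^] d \<notin> M"
  proof
    assume "\<one> \<ominus> p [^] d \<in> M"
    then have "(\<one> \<ominus> p [^] d) \<oplus> p [^] d \<in> M" using dM by (rule M.a_closed)
    moreover have "(\<one> \<ominus> p [^] d) \<oplus> p [^] d = \<one>"
      using dc by algebra
    ultimately show False using M.one_imp_carrier M.I_notcarr by auto
  qed
  then have unit: "\<one> \<ominus> p [^] d \<in> Units R"
    using dc by (intro not_in_maximalideal_Units[OF fin M]) auto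
  have "p [^] a \<otimes> (\<one> \<ominus> p [^] d) = p [^] a \<ominus> p [^] a \<otimes> p [^] d"
    using pc dc by (simp add: a_minus_def r_distr r_minus)
  also have "\<dots> = \<zero>"
    using pc by (simp add: nat_pow_mult d(2)[symmetric] r_right_minus_eq)
  finally have "(\<one> \<ominus> p [^] d) \<otimes> p [^] a = (\<one> \<ominus> p [^] d) \<otimes> \<zero>"
    using pc dc unit by (simp add: m_comm Units_closed)
  then have "p [^] a = \<zero>"
    using unit pc by (subst (asm) Units_l_cancel) auto
  then show thesis by (rule that)
qed

text \<open>As long as the cofactor of a power of \<open>p\<close> is not a unit, it lies in
  \<open>M\<close> and yields another factor \<open>p\<close>. If this never stopped,
  \<open>x\<close> would be a multiple of p^n = 0.\<close>

lemma (in local_cring) generator_power_times_unit: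
  fixes n :: nat
  assumes fin: "finite (carrier R)" and M: "maximalideal M R" "M = PIdl p"
    and p: "p \<in> carrier R" and n: "p [^] n = \<zero>"
    and x: "x \<in> carrier R" "x \<noteq> \<zero>"
  shows "\<exists>k::nat. \<exists>u\<in>Units R. x = p [^] k \<otimes> u"
proof (rule ccontr)
  assume none: "\<not> ?thesis"
  have "\<exists>y\<in>carrier R. x = p [^] j \<otimes> y" for j :: nat
  proof (induction j)
    case 0
    show ?case using x by auto
  next
    case (Suc j)
    then obtain y where y: "y \<in> carrier R" "x = p [^] j \<otimes> y" by auto
    with none have "y \<in> M"
      using not_in_maximalideal_Units[OF fin M(1)] by blast
    then obtain z where z: "z \<in> carrier R" "y = z \<otimes> p"
      unfolding M(2) cgenideal_def by auto
    have "x = p [^] Suc j \<otimes> z"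
      using y z p by (simp add: m_ac)
    with z show ?case by blast
  qed
  from this[of n] n x show False by auto
qed

section \<open>Zero-divisor graphs are threshold graphs\<close>

lemma (in cring) pair_graph_zero_divisor_graph:
  assumes "finite (carrier R)"
  shows "pair_graph (zero_divisor_graph R)"
proof -
  let ?V = "zero_divisor_verts R"
  have fin: "finite ?V"
    using assms unfolding zero_divisor_verts_def by simp
  have "finite (parcs (zero_divisor_graph R))"
    by (rule finite_subset[of _ "?V \<times> ?V"]) (use fin in \<open>auto simp: zero_divisor_graph_def\<close>)
  moreover have "symmetric (with_proj (zero_divisor_graph R))"
    by (auto simp: symmetric_def sym_def zero_divisor_graph_def zero_divisor_verts_def m_comm)
  ultimately show ?thesis
    using fin by unfold_locales (auto simp: zero_divisor_graph_def)
qed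

lemma (in local_cring) threshold_graph_zero_divisor_graph:
  assumes fin: "finite (carrier R)" and M: "maximalideal M R" "principalideal M R"
  shows "threshold_graph (zero_divisor_graph R)"
proof -
  interpret M: maximalideal M R by (fact M(1))
  obtain p where p: "p \<in> carrier R" "M = PIdl p"
    using principalideal.generate[OF M(2)] by (auto simp: cgenideal_eq_genideal)
  then have "p \<in> M" by (auto intro: cgenideal_self)
  then obtain n0 :: nat where n0: "p [^] n0 = \<zero>"
    using maximalideal_member_nilpotent[OF fin M(1)] by blast
  \<comment> \<open>Minimality is what makes p^j vanish exactly from j = n onwards.\<close>
  define n :: nat where "n = (LEAST n. p [^] n = \<zero>)"
  have n: "p [^] n = \<zero>" unfolding n_def using n0 by (rule LeastI)
  have pow0: "p [^] j = \<zero> \<longleftrightarrow> n \<le> j" for j :: nat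
  proof
    assume "n \<le> j"
    then have "p [^] j = p [^] n \<otimes> p [^] (j - n)"
      using p by (simp add: nat_pow_mult)
    then show "p [^] j = \<zero>" using n p by simp
  qed (auto simp: n_def intro: Least_le)
  have "\<forall>x\<in>carrier R - {\<zero>}. \<exists>k::nat. \<exists>u\<in>Units R. x = p [^] k \<otimes> u"
    using generator_power_times_unit[OF fin M(1) p(2,1) n] by auto
  then obtain k :: "'a \<Rightarrow> nat"
    where k: "\<And>x. x \<in> carrier R \<Longrightarrow> x \<noteq> \<zero> \<Longrightarrow> \<exists>u\<in>Units R. x = p [^] k x \<otimes> u"
    by (metis DiffI singletonD)
  \<comment> \<open>The two unit factors multiply to a unit, which cancels and leaves only the power
    of \<open>p\<close> to be tested.\<close>
  have mult: "x \<otimes> y = \<zero> \<longleftrightarrow> n \<le> k x + k y"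
    if xy: "x \<in> carrier R" "x \<noteq> \<zero>" "y \<in> carrier R" "y \<noteq> \<zero>" for x y
  proof -
    obtain u v where u: "u \<in> Units R" "x = p [^] k x \<otimes> u"
      and v: "v \<in> Units R" "y = p [^] k y \<otimes> v"
      using k xy by meson
    have "x \<otimes> y = (p [^] k x \<otimes> u) \<otimes> (p [^] k y \<otimes> v)"
      using u(2) v(2) by simp
    also have "\<dots> = (u \<otimes> v) \<otimes> (p [^] k x \<otimes> p [^] k y)"
      using u(1) v(1) p by (simp add: m_ac Units_closed)
    also have "\<dots> = (u \<otimes> v) \<otimes> p [^] (k x + k y)"
      using p by (simp add: nat_pow_mult)
    finally have "x \<otimes> y = \<zero> \<longleftrightarrow> (u \<otimes> v) \<otimes> p [^] (k x + k y) = (u \<otimes> v) \<otimes> \<zero>"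
      using u v by (simp add: Units_closed)
    also have "\<dots> \<longleftrightarrow> p [^] (k x + k y) = \<zero>"
      using u(1) v(1) p by (intro Units_l_cancel) auto
    finally show ?thesis by (simp add: pow0)
  qed
  have "\<exists>(t::real) (w :: 'a \<Rightarrow> real).
    \<forall>u\<in>pverts (zero_divisor_graph R). \<forall>v\<in>pverts (zero_divisor_graph R).
      u \<noteq> v \<longrightarrow> ((u, v) \<in> parcs (zero_divisor_graph R) \<longleftrightarrow> w u + w v > t)"
  proof (intro exI ballI impI)
    fix u v
    assume uv: "u \<in> pverts (zero_divisor_graph R)" "v \<in> pverts (zero_divisor_graph R)" "u \<noteq> v"
    have "(u, v) \<in> parcs (zero_divisor_graph R) \<longleftrightarrow> u \<otimes> v = \<zero>"
      using uv by (auto simp: zero_divisor_graph_def)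
    also have "\<dots> \<longleftrightarrow> n \<le> k u + k v"
      using uv by (intro mult) (auto simp: zero_divisor_graph_def zero_divisor_verts_def)
    \<comment> \<open>Threshold graphs ask for a strict inequality; between integers, at least n
      means more than n - 1.\<close>
    also have "\<dots> \<longleftrightarrow> real (k u) + real (k v) > real n - 1"
      by linarith
    finally show "(u, v) \<in> parcs (zero_divisor_graph R) \<longleftrightarrow> real (k u) + real (k v) > real n - 1" .
  qed
  with pair_graph_zero_divisor_graph[OF fin] show ?thesis
    by (simp add: threshold_graph_def threshold_graph_axioms_def)
qed

section \<open>Embedding threshold graphs\<close>

text \<open>On finitely many vertices the edge sums exceed the threshold by some uniform \<open>e > 0\<close>; scaling
  the weights so that this gap exceeds \<open>3\<close> leaves room for rounding them down.\<close>

lemma (in threshold_graph) integral_weights: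
  obtains k :: "'v \<Rightarrow> int"
  where "\<And>u v. u \<in> pverts G \<Longrightarrow> v \<in> pverts G \<Longrightarrow> u \<noteq> v \<Longrightarrow> (u, v) \<in> parcs G \<longleftrightarrow> k u + k v > 0"
proof -
  obtain t :: real and w :: "'v \<Rightarrow> real"
    where tw: "\<And>u v. u \<in> pverts G \<Longrightarrow> v \<in> pverts G \<Longrightarrow> u \<noteq> v \<Longrightarrow> (u, v) \<in> parcs G \<longleftrightarrow> w u + w v > t"
    using threshold by blast
  \<comment> \<open>The extra element 1 keeps the minimum defined and positive when there are no
    edges.\<close>
  define S where "S = insert 1 ((\<lambda>(u, v). w u + w v - t) ` parcs G)"
  have S: "finite S" "S \<noteq> {}"
    using pair_finite_arcs by (auto simp: S_def)
  have "w u + w v > t" if "(u, v) \<in> parcs G" for u v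
    using that tw in_arcsD1 in_arcsD2 no_loops' by blast
  then have "\<forall>s\<in>S. s > 0"
    by (auto simp: S_def)
  then have e: "Min S > 0"
    using S by simp
  have gap: "w u + w v - t \<ge> Min S" if "(u, v) \<in> parcs G" for u v
    using that S by (intro Min_le) (auto simp: S_def)
  obtain K :: nat where K: "real K * Min S > 3"
    using reals_Archimedean3[OF e] by blast
  \<comment> \<open>Each endpoint absorbs half of the threshold, which moves the threshold to
    0.\<close>
  define k where "k v = \<lfloor>real K * (w v - t / 2)\<rfloor>" for v
  have "(u, v) \<in> parcs G \<longleftrightarrow> k u + k v > 0"
    if uv: "u \<in> pverts G" "v \<in> pverts G" "u \<noteq> v" for u v
  proof -
    have sum: "real K * (w u - t / 2) + real K * (w v - t / 2) = real K * (w u + w v - t)"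
      by (simp add: algebra_simps)
    show ?thesis
    proof (cases "(u, v) \<in> parcs G")
      case True
      have "real K * (w u + w v - t) \<ge> real K * Min S"
        using gap[OF True] by (intro mult_left_mono) auto
      \<comment> \<open>Two floors lose less than 2 together, so a sum above 3 stays positive. For a
        non-edge, rounding down can only help.\<close>
      with K sum have "k u + k v > 0"
        unfolding k_def by linarith
      with True show ?thesis by simp
    next
      case False
      with tw[OF uv] have "real K * (w u + w v - t) \<le> 0"
        by (intro mult_nonneg_nonpos) auto
      with sum have "\<not> k u + k v > 0"
        unfolding k_def by linarith
      with False show ?thesis by simp
    qed
  qed
  then show thesis by (rule that)
qed

lemma prime_power_mult_eq_iff:
  fixes p i j :: int
  assumes "prime p" "0 < i" "i < p" "0 < j" "j < p"
  shows "p ^ a * i = p ^ b * j \<longleftrightarrow> a = b \<and> i = j"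
proof -
  have p0: "p > 0" using assms by linarith
  \<comment> \<open>If a < b, cancelling p^a would make \<open>p\<close> divide \<open>i\<close>,
    impossible for 0 < i < p. Exchanging the two sides gives the other inequality.\<close>
  have key: "a \<ge> b" if "p ^ a * i = p ^ b * j" "0 < i" "i < p" for a b and i j :: int
  proof (rule ccontr)
    assume "\<not> a \<ge> b"
    then obtain d where "b = a + Suc d"
      by (metis add_Suc_right less_imp_Suc_add not_le)
    with that p0 have "i = p ^ Suc d * j"
      by (simp add: power_add)
    then have "p dvd i" by simp
    with that show False by (auto dest: zdvd_imp_le)
  qed
  have "a = b" if "p ^ a * i = p ^ b * j"
    using key[OF that assms(2,3)] key[OF that[symmetric] assms(4,5)] by simp
  with p0 show ?thesis by auto
qed

text \<open>Both cofactors are prime to \<open>p\<close>, so the product has \<open>p\<close>-adic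
  valuation exactly \<open>a + b\<close>. One more factor \<open>p\<close> would have to divide
  \<open>i * j\<close>.\<close>

lemma prime_power_dvd_mult_iff:
  fixes p i j :: int
  assumes "prime p" "\<not> p dvd i" "\<not> p dvd j"
  shows "p ^ n dvd (p ^ a * i) * (p ^ b * j) \<longleftrightarrow> n \<le> a + b"
proof
  assume "n \<le> a + b"
  then have "p ^ n dvd p ^ (a + b) * (i * j)"
    by (intro dvd_mult2 le_imp_power_dvd)
  then show "p ^ n dvd (p ^ a * i) * (p ^ b * j)"
    by (simp add: power_add mult_ac)
next
  assume dvd: "p ^ n dvd (p ^ a * i) * (p ^ b * j)"
  show "n \<le> a + b"
  proof (rule ccontr)
    assume "\<not> n \<le> a + b"
    then have "p ^ Suc (a + b) dvd p ^ n"
      by (intro le_imp_power_dvd) auto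
    then have "p ^ Suc (a + b) dvd (p ^ a * i) * (p ^ b * j)"
      using dvd by (rule dvd_trans)
    then have "p ^ (a + b) * p dvd p ^ (a + b) * (i * j)"
      by (simp add: power_add mult_ac)
    moreover have "p ^ (a + b) \<noteq> 0" using assms(1) by auto
    ultimately have "p dvd i * j" by (subst (asm) dvd_mult_cancel_left) auto
    with assms show False by (simp add: prime_dvd_mult_iff)
  qed
qed

text \<open>Because \<open>p\<close> divides the modulus, reduction preserves divisibility by
  \<open>p\<close>. Hence the ideal generated by \<open>p\<close> consists of the multiples of
  \<open>p\<close>, which are exactly the residues not coprime to p^n, that is, the
  non-units.\<close>

lemma residue_ring_prime_power:
  fixes p :: int
  assumes p: "prime p" and n: "n > 1"
  defines "R \<equiv> residue_ring (p ^ n)"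
  shows "local_cring R" "maximalideal (PIdl\<^bsub>R\<^esub> p) R" "principalideal (PIdl\<^bsub>R\<^esub> p) R"
proof -
  have p1: "p > 1" using p by (rule prime_gt_1_int)
  \<comment> \<open>With n > 1 the integer \<open>p\<close> is its own residue and so an element of
    the carrier.\<close>
  have pn: "p < p ^ n" using p1 n power_strict_increasing[of 1 n p] by simp
  interpret residues "p ^ n" R
    using p1 pn by unfold_locales (auto simp: R_def)
  have pc: "p \<in> carrier R" using p1 pn by (simp add: res_carrier_eq)
  have pdvd: "p dvd p ^ n" using n by (simp add: dvd_power)
  have "x \<in> PIdl\<^bsub>R\<^esub> p \<longleftrightarrow> x \<in> carrier R \<and> p dvd x" for x
  proof
    assume "x \<in> PIdl\<^bsub>R\<^esub> p"
    then show "x \<in> carrier R \<and> p dvd x"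
      using pc pdvd by (auto simp: cgenideal_def res_mult_eq dvd_mod_iff)
  next
    assume x: "x \<in> carrier R \<and> p dvd x"
    then obtain y where y: "x = p * y" by blast
    have y0: "y \<ge> 0"
      using x y p1 by (auto simp: res_carrier_eq zero_le_mult_iff)
    then have "y \<le> x" using y p1 mult_right_mono[of 1 p y] by simp
    then have "y \<in> carrier R" using x y0 by (auto simp: res_carrier_eq)
    moreover have "x = y \<otimes>\<^bsub>R\<^esub> p"
      using x y by (simp add: res_mult_eq res_carrier_eq mult.commute)
    ultimately show "x \<in> PIdl\<^bsub>R\<^esub> p" by (auto simp: cgenideal_def)
  qed
  moreover have "x \<in> Units R \<longleftrightarrow> x \<in> carrier R \<and> \<not> p dvd x" for x
  proof -
    have "coprime x (p ^ n) \<longleftrightarrow> \<not> p dvd x"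
      using p n prime_imp_coprime[OF p] not_prime_unit
      by (auto simp: coprime_commute[of x p] coprime_absorb_left)
    moreover have "x \<noteq> 0" if "\<not> p dvd x" using that by auto
    ultimately show ?thesis by (auto simp: res_units_eq res_carrier_eq)
  qed
  ultimately have eq: "PIdl\<^bsub>R\<^esub> p = carrier R - Units R" by auto
  have "ideal (carrier R - Units R) R"
    using cgenideal_ideal[OF pc] by (simp only: eq)
  from local_cring_if_ideal_nonunits[OF this]
  show "local_cring R" "maximalideal (PIdl\<^bsub>R\<^esub> p) R" by (simp_all only: eq)
  show "principalideal (PIdl\<^bsub>R\<^esub> p) R" by (rule cgenideal_is_principalideal[OF pc])
qed

text \<open>The subgraph is the image of \<open>G\<close>, with \<open>f\<close> acting on arcs
  componentwise. The equivalence on arcs makes its arcs all those of \<open>H\<close> between image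
  vertices, hence it is induced.\<close>

lemma digraph_iso_induced_subgraph_with_proj:
  fixes f :: "'a \<Rightarrow> 'b"
  assumes G: "pair_wf_digraph G" and H: "pair_wf_digraph H"
    and f: "inj_on f (pverts G)" "f ` pverts G \<subseteq> pverts H"
    and arcs: "\<And>u v. u \<in> pverts G \<Longrightarrow> v \<in> pverts G \<Longrightarrow> (f u, f v) \<in> parcs H \<longleftrightarrow> (u, v) \<in> parcs G"
  shows "\<exists>H'. induced_subgraph H' (with_proj H) \<and> digraph_iso (with_proj G) H'"
proof -
  note arcsD = pair_wf_digraph.in_arcsD1[OF G] pair_wf_digraph.in_arcsD2[OF G]
  let ?h = "\<lparr>iso_verts = f, iso_arcs = map_prod f f, iso_head = snd, iso_tail = fst\<rparr>"
  let ?H = "app_iso ?h (with_proj G)"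
  have arcs_eq: "arcs ?H = {e \<in> parcs H. fst e \<in> f ` pverts G \<and> snd e \<in> f ` pverts G}"
  proof (intro subset_antisym subsetI)
    fix e assume "e \<in> arcs ?H"
    then obtain u v where "(u, v) \<in> parcs G" "e = (f u, f v)" by auto
    then show "e \<in> {e \<in> parcs H. fst e \<in> f ` pverts G \<and> snd e \<in> f ` pverts G}"
      using arcs[of u v] arcsD by auto
  next
    fix e assume "e \<in> {e \<in> parcs H. fst e \<in> f ` pverts G \<and> snd e \<in> f ` pverts G}"
    then obtain u v where uv: "u \<in> pverts G" "v \<in> pverts G" "e = (f u, f v)" "e \<in> parcs H"
      by (cases e) auto
    then have "(u, v) \<in> parcs G" using arcs by simp
    then have "map_prod f f (u, v) \<in> map_prod f f ` parcs G" by (rule imageI)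
    with uv(3) show "e \<in> arcs ?H" by simp
  qed
  have "inj_on (map_prod f f) (parcs G)"
    by (rule inj_on_subset[OF map_prod_inj_on[OF f(1) f(1)]])
      (auto dest: arcsD)
  then have "pre_digraph.digraph_isomorphism (with_proj G) ?h"
    using f(1) by (simp add: pre_digraph.digraph_isomorphism_def wf_digraph_wp_iff G)
  then have "digraph_iso (with_proj G) ?H"
    unfolding digraph_iso_def by blast
  moreover have "wf_digraph ?H"
    by (rule wf_digraph.intro) (auto simp: arcs_eq simp del: arcs_app_iso)
  then have "induced_subgraph ?H (with_proj H)"
    unfolding induced_subgraph_def subgraph_def compatible_def
    using f(2) arcs_eq by (simp add: wf_digraph_wp_iff H)
  ultimately show ?thesis by blast
qed

text \<open>A vertex of integral weight \<open>k\<close> becomes an element of \<open>p\<close>-adic valuation \<open>L + k\<close> in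
  \<open>\<int>/p\<^sup>2\<^sup>L\<^sup>+\<^sup>1\<close>; the factor \<open>g v < p\<close> separates vertices of equal weight.\<close>

lemma (in threshold_graph) embeds_in_zero_divisor_graph:
  "\<exists>(R :: int ring) M.
     local_cring R \<and> finite (carrier R) \<and> maximalideal M R \<and> principalideal M R \<and>
     (\<exists>H. induced_subgraph H (with_proj (zero_divisor_graph R)) \<and> digraph_iso (with_proj G) H)"
proof -
  obtain k :: "'v \<Rightarrow> int"
    where k: "\<And>u v. u \<in> pverts G \<Longrightarrow> v \<in> pverts G \<Longrightarrow> u \<noteq> v \<Longrightarrow> (u, v) \<in> parcs G \<longleftrightarrow> k u + k v > 0"
    using integral_weights by blast
  obtain g :: "'v \<Rightarrow> nat" where g: "inj_on g (pverts G)" "g ` pverts G \<subseteq> {1..card (pverts G)}"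
    using finite_same_card_bij[OF pair_finite_verts, of "{1..card (pverts G)}"]
    by (auto simp: bij_betw_def)
  \<comment> \<open>The labels \<open>g v\<close> run from 1 to the number of vertices, so a prime
    above that number divides none of them.\<close>
  obtain q :: nat where q: "prime q" "q > card (pverts G)"
    using bigger_prime by blast
  define p where "p = int q"
  have p: "prime p" using q by (simp add: p_def)
  have p1: "p > 1" using p by (rule prime_gt_1_int)
  define L where "L = Suc (\<Sum>v\<in>pverts G. nat \<bar>k v\<bar>)"
  have L: "\<bar>k v\<bar> < int L" if "v \<in> pverts G" for v
    using member_le_sum[of v "pverts G" "\<lambda>v. nat \<bar>k v\<bar>"] that pair_finite_verts
    unfolding L_def by linarith
  \<comment> \<open>The valuations of two vertices add up to 2L + k u + k v, which reaches 2L + 1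
    exactly when k u + k v > 0. As \<open>L\<close> exceeds every \<bar>k v\<bar>, each single
    valuation lies strictly between 0 and \<open>N\<close>.\<close>
  define N where "N = 2 * L + 1"
  define a where "a v = nat (int L + k v)" for v
  define f where "f v = p ^ a v * int (g v)" for v
  define R where "R = residue_ring (p ^ N)"
  have a: "0 < a v" "a v < N" if "v \<in> pverts G" for v
    using L[OF that] by (auto simp: a_def N_def)
  have gp: "0 < int (g v)" "int (g v) < p" if "v \<in> pverts G" for v
    using g(2) q(2) that by (force simp: p_def)+
  then have gdvd: "\<not> p dvd int (g v)" if "v \<in> pverts G" for v
    using that by (meson zdvd_not_zless)
  have "N > 1" by (simp add: N_def L_def)
  note R = residue_ring_prime_power[OF p this, folded R_def]
  interpret residues "p ^ N" R
    using p1 \<open>N > 1\<close> by unfold_locales (auto simp: R_def one_less_power)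
  have f_carrier: "f v \<in> carrier R" "f v \<noteq> 0" if "v \<in> pverts G" for v
  proof -
    have "f v < p ^ a v * p"
      unfolding f_def using gp[OF that] p1 by (intro mult_strict_left_mono) auto
    also have "\<dots> = p ^ Suc (a v)" by simp
    also have "\<dots> \<le> p ^ N" using a[OF that] p1 by (intro power_increasing) auto
    finally have "f v < p ^ N" .
    moreover have "f v > 0" unfolding f_def using gp[OF that] p1 by simp
    ultimately show "f v \<in> carrier R" "f v \<noteq> 0" by (auto simp: res_carrier_eq)
  qed
  have f_mult: "f u \<otimes>\<^bsub>R\<^esub> f v = 0 \<longleftrightarrow> N \<le> a u + a v" if "u \<in> pverts G" "v \<in> pverts G" for u v
    unfolding f_def res_mult_eq
    using prime_power_dvd_mult_iff[OF p gdvd gdvd] that by (simp add: mod_eq_0_iff_dvd)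
  have f_verts: "f v \<in> zero_divisor_verts R" if "v \<in> pverts G" for v
  proof -
    \<comment> \<open>The non-zero residue p^(N-1) annihilates \<open>f v\<close>, whose valuation
      is at least 1.\<close>
    have "p ^ N dvd f v * p ^ (N - 1)"
      using prime_power_dvd_mult_iff[OF p gdvd[OF that], of 1 N "a v" "N - 1"] p1 a[OF that]
      by (auto simp: f_def)
    then have "f v \<otimes>\<^bsub>R\<^esub> p ^ (N - 1) = 0" by (simp add: res_mult_eq)
    moreover have "p ^ (N - 1) \<in> carrier R" "p ^ (N - 1) \<noteq> 0"
      using p1 \<open>N > 1\<close> by (auto simp: res_carrier_eq power_strict_increasing)
    ultimately have "\<exists>b\<in>carrier R. b \<noteq> 0 \<and> f v \<otimes>\<^bsub>R\<^esub> b = 0" by blast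
    with f_carrier[OF that] show ?thesis by (simp add: zero_divisor_verts_def res_zero_eq)
  qed
  have inj: "inj_on f (pverts G)"
    unfolding f_def using g(1) gp by (auto simp: inj_on_def prime_power_mult_eq_iff[OF p])
  have "(f u, f v) \<in> parcs (zero_divisor_graph R) \<longleftrightarrow> (u, v) \<in> parcs G"
    if uv: "u \<in> pverts G" "v \<in> pverts G" for u v
  proof (cases "u = v")
    case True
    then show ?thesis by (auto simp: zero_divisor_graph_def dest: no_loops')
  next
    case False
    then have "f u \<noteq> f v" using inj uv by (auto dest: inj_onD)
    then have "(f u, f v) \<in> parcs (zero_divisor_graph R) \<longleftrightarrow> N \<le> a u + a v"
      using uv f_verts f_mult by (simp add: zero_divisor_graph_def res_zero_eq)
    also have "\<dots> \<longleftrightarrow> k u + k v > 0"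
      using L[OF uv(1)] L[OF uv(2)] by (auto simp: a_def N_def)
    finally show ?thesis using k[OF uv False] by simp
  qed
  moreover have "pair_wf_digraph (zero_divisor_graph R)"
    using pair_graph_zero_divisor_graph by (simp add: pair_graph_def pair_digraph_def pair_fin_digraph_def)
  moreover have "pair_wf_digraph G" ..
  moreover have "f ` pverts G \<subseteq> pverts (zero_divisor_graph R)"
    using f_verts by (auto simp: zero_divisor_graph_def)
  ultimately have "\<exists>H. induced_subgraph H (with_proj (zero_divisor_graph R)) \<and> digraph_iso (with_proj G) H"
    using inj by (intro digraph_iso_induced_subgraph_with_proj)
  with R finite show ?thesis by blast
qed

theorem theorem3p2:
  shows "(\<forall>(R :: ('r, 'm) ring_scheme) M.
            local_cring R \<and> finite (carrier R) \<and> maximalideal M R \<and> principalideal M R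
            \<longrightarrow> threshold_graph (zero_divisor_graph R))
       \<and> (\<forall>G :: 'v pair_pre_digraph. threshold_graph G \<longrightarrow>
            (\<exists>(R :: int ring) M.
               local_cring R \<and> finite (carrier R) \<and> maximalideal M R \<and> principalideal M R \<and>
               (\<exists>H. induced_subgraph H (with_proj (zero_divisor_graph R)) \<and>
                    digraph_iso (with_proj G) H)))"
  using local_cring.threshold_graph_zero_divisor_graph threshold_graph.embeds_in_zero_divisor_graph
  by blast

end
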